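(* Let $\mathbf{c}$ be a complexity function on finite groups which also satisfies the subgroup axiom: whenever $H$ is a subgroup of a finite group $G$, $\mathbf{c}(H)\le\mathbf{c}(G)$. Then $\mathbf{c}(G)\le 1$ for every finite group $G$.
   Context: All groups are finite. Functions $\mathbf{c}$ go from the class of finite groups to $\mathbb{N}=\{0,1,2,\dots\}$. The complexity axioms for $\mathbf{c}$ are the following five. (Extension) If $N\lhd G$, then $\mathbf{c}(G)\le \mathbf{c}(N)+\mathbf{c}(G/N)$. (Quotient) If there is a surjective homomorphism $G\to H$, then $\mathbf{c}(G)\ge \mathbf{c}(H)$. (Constructability) Every group $G$ has a subnormal series $\mathbf{1}=G_n\lhd G_{n-1}\lhd\cdots\lhd G_0=G$ (some $n\ge 0$) with $\mathbf{c}(G_i/G_{i+1})\le 1$ for all $0\le i<n$. (Product) If $G=H\times K$, then $\mathbf{c}(G)=\max(\mathbf{c}(H),\mathbf{c}(K))$. (Initial condition) $\mathbf{c}(\mathbf{1})=0$ for the trivial group $\mathbf{1}$. A complexity function (or complexity measure) is a function satisfying these five axioms. *)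

theory Defs
  imports "HOL-Algebra.Algebra"
begin

text \<open>
  HOL has no type of all finite groups. A function on the class of finite groups is given by its
  values on groups with elements in \<^typ>\<open>nat\<close>; every finite group is isomorphic to such a group
  (lemma \<open>ex_nat_copy\<close>). The value at a finite group over any other type (quotients, direct
  products) is the value at a copy over \<^typ>\<open>nat\<close>. The choice of the copy is immaterial, since the
  quotient axiom makes the function invariant under isomorphism (lemma \<open>value_at_eq\<close>).
\<close>

definition value_at :: "(nat monoid \<Rightarrow> nat) \<Rightarrow> ('a, 'm) monoid_scheme \<Rightarrow> nat" where
  "value_at c G = c (SOME H. group H \<and> G \<cong> H)"

locale complexity_function =
  fixes c :: "nat monoid \<Rightarrow> nat"
  assumes extension:
    "\<And>(G :: nat monoid) N. group G \<Longrightarrow> finite (carrier G) \<Longrightarrow> N \<lhd> G \<Longrightarrow>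
       c G \<le> c (G\<lparr>carrier := N\<rparr>) + value_at c (G Mod N)"
  and quotient:
    "\<And>(G :: nat monoid) (H :: nat monoid) f. group G \<Longrightarrow> finite (carrier G) \<Longrightarrow> group H \<Longrightarrow> finite (carrier H) \<Longrightarrow>
       f \<in> epi G H \<Longrightarrow> c H \<le> c G"
  and constructability:
    "\<And>G :: nat monoid. group G \<Longrightarrow> finite (carrier G) \<Longrightarrow>
       \<exists>(n::nat) S. S 0 = carrier G \<and> S n = {\<one>\<^bsub>G\<^esub>} \<and>
         (\<forall>i<n. S (Suc i) \<lhd> G\<lparr>carrier := S i\<rparr> \<and>
                value_at c (G\<lparr>carrier := S i\<rparr> Mod S (Suc i)) \<le> 1)"
  and product:
    "\<And>(H :: nat monoid) (K :: nat monoid). group H \<Longrightarrow> finite (carrier H) \<Longrightarrow> group K \<Longrightarrow> finite (carrier K) \<Longrightarrow>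
       value_at c (H \<times>\<times> K) = max (c H) (c K)"
  and initial:
    "\<And>G :: nat monoid. group G \<Longrightarrow> carrier G = {\<one>\<^bsub>G\<^esub>} \<Longrightarrow> c G = 0"

definition subgroup_axiom :: "(nat monoid \<Rightarrow> nat) \<Rightarrow> bool" where
  "subgroup_axiom c \<longleftrightarrow>
     (\<forall>(G :: nat monoid) H. group G \<longrightarrow> finite (carrier G) \<longrightarrow> subgroup H G \<longrightarrow> c (G\<lparr>carrier := H\<rparr>) \<le> c G)"

lemma ex_nat_copy:
  fixes G :: "('a, 'm) monoid_scheme"
  assumes "group G" "finite (carrier G)"
  shows "\<exists>H :: nat monoid. group H \<and> G \<cong> H"
proof -
  obtain f :: "'a \<Rightarrow> nat" where f: "inj_on f (carrier G)"
    using finite_imp_inj_to_nat_seg[OF assms(2)] by blast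
  show ?thesis
    using group.inj_imp_image_group_is_group[OF assms(1) f] inj_imp_image_group_iso[OF f]
    by (auto simp: is_iso_def)
qed

lemma (in complexity_function) iso_invariant:
  assumes "group G" "finite (carrier G)" "group H" "G \<cong> H"
  shows "c G = c H"
proof -
  have fin: "finite (carrier H)"
    using assms iso_finite by blast
  have le: "c K \<le> c L"
    if "group K" "finite (carrier K)" "group L" "finite (carrier L)" "L \<cong> K" for K L
    using that quotient[of L K] by (auto simp: is_iso_def iso_def epi_def bij_betw_def)
  show ?thesis
    using le[OF assms(1,2,3) fin] le[OF assms(3) fin assms(1,2) assms(4)]
      group.iso_sym[OF assms(1,4)] by simp
qed

lemma (in complexity_function) value_at_eq:
  fixes G :: "('a, 'm) monoid_scheme"
  assumes "group G" "finite (carrier G)" "group H" "G \<cong> H"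
  shows "value_at c G = c H"
proof -
  define K :: "nat monoid" where "K = (SOME H. group H \<and> G \<cong> H)"
  have K: "group K" "G \<cong> K"
    using someI_ex[OF ex_nat_copy[OF assms(1,2)]] by (simp_all add: K_def)
  have "K \<cong> H"
    using iso_trans[OF group.iso_sym[OF assms(1) K(2)] assms(4)] .
  moreover have "finite (carrier K)"
    using assms(2) K(2) iso_finite by blast
  ultimately show ?thesis
    using iso_invariant[OF K(1) _ assms(3)] by (simp add: value_at_def K_def)
qed

lemma (in complexity_function) value_at_nat:
  assumes "group G" "finite (carrier G)"
  shows "value_at c G = c G"
  by (rule value_at_eq[OF assms assms(1) iso_refl])

end

theory Submission
  imports Defs
begin

text \<open>
  Every finite group embeds into a symmetric group and hence into an alternating group of large
  degree. The latter is simple, so its only subnormal series is the trivial one (up to repetitions),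
  and constructability bounds its complexity by 1. The subgroup axiom does the rest.
\<close>

section \<open>Simplicity of alternating groups\<close>

lemma three_cycle_in_alt_group:
  assumes "distinct [a, b, c]" "{a, b, c} \<subseteq> {1..n}"
  shows "cycle_of_list [a, b, c] \<in> carrier (alt_group n)"
proof -
  have "cycle_of_list [a, b, c] \<in> three_cycles n"
    using assms by (intro CollectI exI[of _ "[a, b, c]"]) simp
  then show ?thesis
    using three_cycles_incl by blast
qed

lemma alt_group_normal_conj:
  assumes N: "N \<lhd> alt_group n" and p: "p \<in> N" and q: "q \<in> carrier (alt_group n)"
  shows "q \<circ> p \<circ> inv' q \<in> N"
  using normal.inv_op_closed2[OF N q p] alt_group_inv_equality[OF q]
  by (simp add: alt_group_mult)

text \<open>The commutator is \<open>p\<close> times the conjugate of \<open>inv' p\<close> by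
  \<open>q\<close>, and both factors lie in \<open>N\<close>.\<close>

lemma alt_group_normal_commutator:
  assumes N: "N \<lhd> alt_group n" and p: "p \<in> N" and q: "q \<in> carrier (alt_group n)"
  shows "p \<circ> q \<circ> inv' p \<circ> inv' q \<in> N"
proof -
  have sub: "subgroup N (alt_group n)"
    using N by (rule normal_imp_subgroup)
  have pA: "p \<in> carrier (alt_group n)"
    using subgroup.mem_carrier[OF sub p] .
  have "inv' p \<in> N"
    using subgroup.m_inv_closed[OF sub p] alt_group_inv_equality[OF pA] by simp
  from subgroup.m_closed[OF sub p alt_group_normal_conj[OF N this q]]
  show ?thesis
    by (simp add: alt_group_mult o_assoc)
qed

text \<open>This makes all three-cycles conjugate inside the alternating group. A permutation with
  the prescribed values is built from transpositions; if it is odd, composing it with a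
  transposition of two points outside \<open>{x, y, z}\<close> repairs the sign without disturbing
  these values. Five points leave room for that.\<close>

lemma alt_group_3_transitive:
  assumes n: "n \<ge> 5" and abc: "distinct [a, b, c]" "{a, b, c} \<subseteq> {1..n}"
    and xyz: "distinct [x, y, z]" "{x, y, z} \<subseteq> {1..n}"
  obtains q where "q \<in> carrier (alt_group n)" "q a = x" "q b = y" "q c = z"
proof -
  \<comment> \<open>Each transposition corrects one more image and keeps the earlier ones:
    \<open>r1\<close> sends \<open>a\<close> to \<open>x\<close>, \<open>r2\<close> also
    \<open>b\<close> to \<open>y\<close>, and \<open>r\<close> also \<open>c\<close> to
    \<open>z\<close>.\<close>
  define r1 where "r1 = transpose a x"
  define r2 where "r2 = transpose (r1 b) y \<circ> r1"
  define r where "r = transpose (r2 c) z \<circ> r2"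
  have r1: "r1 permutes {1..n}"
    unfolding r1_def using abc xyz by (intro permutes_swap_id) auto
  have r2: "r2 permutes {1..n}"
    unfolding r2_def using abc xyz permutes_in_image[OF r1]
    by (intro permutes_compose[OF r1] permutes_swap_id) auto
  have r: "r permutes {1..n}"
    unfolding r_def using abc xyz permutes_in_image[OF r2]
    by (intro permutes_compose[OF r2] permutes_swap_id) auto
  have "r1 a = x" "r1 b \<noteq> x"
    using abc by (auto simp: r1_def transpose_def)
  then have r2ab: "r2 a = x" "r2 b = y"
    using xyz by (auto simp: r2_def transpose_def)
  moreover have "r2 c \<noteq> x" "r2 c \<noteq> y"
    using abc permutes_inj[OF r2] r2ab by (auto simp: inj_def)
  ultimately have rabc: "r a = x" "r b = y" "r c = z"
    using xyz by (auto simp: r_def transpose_def)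
  show thesis
  proof (cases "evenperm r")
    case True
    then show thesis
      using that[of r] r rabc by (simp add: alt_group_carrier)
  next
    case False
    have "card ({1..n} - {x, y, z}) = n - 3"
      using xyz by (subst card_Diff_subset) auto
    then have "card ({1..n} - {x, y, z}) \<ge> 2"
      using n by simp
    then obtain u v where uv: "u \<in> {1..n} - {x, y, z}" "v \<in> {1..n} - {x, y, z}" "u \<noteq> v"
      by (rule obtain_subset_with_card_n) (auto simp: card_2_iff)
    have "evenperm (transpose u v \<circ> r)"
      using False uv r evenperm_comp[OF permutation_swap_id, of r u v]
      by (auto simp: evenperm_swap permutation_permutes)
    moreover have "(transpose u v \<circ> r) permutes {1..n}"
      using uv by (intro permutes_compose[OF r] permutes_swap_id) auto
    moreover have "(transpose u v \<circ> r) a = x" "(transpose u v \<circ> r) b = y" "(transpose u v \<circ> r) c = z"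
      using uv rabc by (auto simp: transpose_def)
    ultimately show thesis
      using that[of "transpose u v \<circ> r"] by (simp add: alt_group_carrier)
  qed
qed

text \<open>By 3-transitivity every three-cycle is a conjugate of the given one, and the
  three-cycles generate the alternating group.\<close>

lemma alt_group_normal_three_cycle:
  assumes n: "n \<ge> 5" and N: "N \<lhd> alt_group n"
    and abc: "distinct [a, b, c]" "{a, b, c} \<subseteq> {1..n}" "cycle_of_list [a, b, c] \<in> N"
  shows "N = carrier (alt_group n)"
proof -
  have sub: "subgroup N (alt_group n)"
    using N by (rule normal_imp_subgroup)
  have "three_cycles n \<subseteq> N"
  proof
    fix p assume "p \<in> three_cycles n"
    then obtain cs where cs: "p = cycle_of_list cs" "cycle cs" "length cs = 3" "set cs \<subseteq> {1..n}"
      by auto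
    obtain x y z where xyz: "cs = [x, y, z]"
      using stupid_lemma[OF cs(3)] by blast
    obtain q where q: "q \<in> carrier (alt_group n)" "q a = x" "q b = y" "q c = z"
      using alt_group_3_transitive[OF n abc(1,2), of x y z] cs xyz by auto
    have "bij q"
      using q(1) permutes_bij by (auto simp: alt_group_carrier)
    then have "q \<circ> cycle_of_list [a, b, c] \<circ> inv' q = p"
      using conjugation_of_cycle[OF abc(1), of q] q cs xyz by simp
    then show "p \<in> N"
      using alt_group_normal_conj[OF N abc(3) q(1)] by simp
  qed
  then have "carrier (alt_group n) \<subseteq> N"
    using group.generate_subgroup_incl[OF alt_group_is_group _ sub]
    by (simp add: alt_group_carrier_as_three_cycles)
  then show ?thesis
    using subgroup.subset[OF sub] by blast
qed

text \<open>A three-cycle in \<open>N\<close> is produced from \<open>p\<close>: conjugating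
  \<open>(a d e)\<close> by \<open>p\<close> changes only the entry \<open>a\<close>, so the two
  cycles share \<open>d\<close> and \<open>e\<close> and nearly cancel in the commutator.\<close>

lemma alt_group_normal_two_fixpoints:
  assumes n: "n \<ge> 5" and N: "N \<lhd> alt_group n" and p: "p \<in> N" "p a \<noteq> a"
    and fixed: "p d = d" "p e = e" "d \<noteq> e" "d \<in> {1..n}" "e \<in> {1..n}"
  shows "N = carrier (alt_group n)"
proof -
  have "p permutes {1..n}"
    using subgroup.mem_carrier[OF normal_imp_subgroup[OF N] p(1)] by (simp add: alt_group_carrier)
  then have bij: "bij p" and a: "a \<in> {1..n}" and pa: "p a \<in> {1..n}"
    using p(2) permutes_bij permutes_not_in permutes_in_image by metis+
  have inj: "p x = p y \<longleftrightarrow> x = y" for x y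
    using bij by (simp add: bij_is_inj inj_eq)
  have ade: "distinct [a, d, e]"
    using p(2) fixed by auto
  have apd: "distinct [a, p a, d]"
    using ade p(2) fixed inj[of a d] by auto
  define t where "t = cycle_of_list [a, d, e]"
  have t: "t \<in> carrier (alt_group n)"
    unfolding t_def using ade a fixed by (intro three_cycle_in_alt_group) auto
  have "p \<circ> t \<circ> inv' p = cycle_of_list [p a, d, e]"
    using conjugation_of_cycle[OF ade bij] fixed by (simp add: t_def)
  \<comment> \<open>the commutator of \<open>p\<close> and \<open>t\<close> is a three-cycle\<close>
  also have "\<dots> = cycle_of_list [a, p a, d] \<circ> t"
    using ade apd inj[of a e] fixed by (auto simp: t_def fun_eq_iff transpose_def)
  finally have "p \<circ> t \<circ> inv' p \<circ> inv' t = cycle_of_list [a, p a, d] \<circ> (t \<circ> inv' t)"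
    by (simp add: o_assoc)
  also have "t \<circ> inv' t = id"
    using t permutes_inv_o(1) by (auto simp: alt_group_carrier)
  finally have "cycle_of_list [a, p a, d] \<in> N"
    using alt_group_normal_commutator[OF N p(1) t] by (simp only: comp_id)
  then show ?thesis
    using alt_group_normal_three_cycle[OF n N apd] a pa fixed by simp
qed

text \<open>A non-identity element of \<open>N\<close> need not fix any point, so it is first
  replaced by its commutator with a three-cycle. This is a product of two three-cycles with the
  common point \<open>b\<close>, and hence leaves at least two of seven or more points
  fixed.\<close>

theorem alt_group_simple:
  assumes n: "n \<ge> 7"
  shows "simple_group (alt_group n)"
proof (intro simple_group.intro simple_group_axioms.intro)
  show "group (alt_group n)"
    by (rule alt_group_is_group)
  have "(fact 3 :: nat) \<le> fact n"
    using n by (intro fact_mono) simp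
  then have "(6 :: nat) \<le> 2 * card (carrier (alt_group n))"
    using alt_group_card_carrier[of n] n by (simp add: fact_numeral)
  then show "1 < order (alt_group n)"
    by (simp add: order_def)
next
  fix N assume N: "N \<lhd> alt_group n"
  have sub: "subgroup N (alt_group n)"
    using N by (rule normal_imp_subgroup)
  show "N = carrier (alt_group n) \<or> N = {\<one>\<^bsub>alt_group n\<^esub>}"
  proof (cases "N \<subseteq> {id}")
    case True
    then show ?thesis
      using subgroup.one_closed[OF sub] by (auto simp: alt_group_one)
  next
    case False
    then obtain p where p: "p \<in> N" "p \<noteq> id"
      by auto
    then obtain a where pa: "p a \<noteq> a"
      by (auto simp: fun_eq_iff)
    have perm: "p permutes {1..n}"
      using subgroup.mem_carrier[OF sub p(1)] by (simp add: alt_group_carrier)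
    then have bij: "bij p"
      by (rule permutes_bij)
    have inj: "p x = p y \<longleftrightarrow> x = y" for x y
      using bij by (simp add: bij_is_inj inj_eq)
    define b where "b = p a"
    have a: "a \<in> {1..n}"
      using perm pa permutes_not_in by metis
    have b: "b \<in> {1..n}"
      unfolding b_def using a permutes_in_image[OF perm, of a] by blast
    have "card {a, b, p b} \<le> 3"
      by (simp add: card_insert_if)
    then have "\<not> {1..n} \<subseteq> {a, b, p b}"
      using n card_mono[of "{a, b, p b}" "{1..n}"] by auto
    \<comment> \<open>Avoiding \<open>a\<close> and \<open>b\<close> gives a genuine three-cycle
      \<open>t\<close>; avoiding \<open>p b\<close> makes the commutator nontrivial, since
      \<open>k\<close> will send \<open>c\<close> to \<open>p b\<close>.\<close>
    then obtain c where "c \<in> {1..n}" "c \<notin> {a, b, p b}"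
      by blast
    then have c: "c \<in> {1..n}" "c \<noteq> a" "c \<noteq> b" "c \<noteq> p b"
      by simp_all
    have abc: "distinct [a, b, c]"
      using pa c by (auto simp: b_def)
    define t where "t = cycle_of_list [a, b, c]"
    have t: "t \<in> carrier (alt_group n)"
      unfolding t_def using abc a b c by (intro three_cycle_in_alt_group) auto
    then have bij_t: "bij t"
      using permutes_bij by (auto simp: alt_group_carrier)
    have conj: "p \<circ> t \<circ> inv' p = cycle_of_list [b, p b, p c]"
      using conjugation_of_cycle[OF abc bij] by (simp add: t_def b_def)
    \<comment> \<open>moves at most the five points \<open>a, b, c, p b, p c\<close>\<close>
    define k where "k = p \<circ> t \<circ> inv' p \<circ> inv' t"
    have kN: "k \<in> N"
      unfolding k_def by (rule alt_group_normal_commutator[OF N p(1) t])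
    \<comment> \<open>Evaluating at \<open>t x\<close> cancels the factor \<open>inv' t\<close>, so
      no inverse has to be computed.\<close>
    have kt: "k (t x) = cycle_of_list [b, p b, p c] x" for x
      using bij_t fun_cong[OF conj, of x] by (simp add: k_def bij_is_inj)
    have "t b = c" "cycle_of_list [b, p b, p c] b = p b"
      using abc inj[of b c] inj[of a b] inj[of a c] by (auto simp: t_def b_def transpose_def)
    then have kc: "k c \<noteq> c"
      using kt[of b] c by simp
    have kfix: "k x = x" if "x \<notin> {a, b, c, p b, p c}" for x
    proof -
      have "t x = x" "cycle_of_list [b, p b, p c] x = x"
        using that by (auto simp: t_def transpose_def)
      then show ?thesis
        using kt[of x] by simp
    qed
    have "card {a, b, c, p b, p c} \<le> 5"
      by (simp add: card_insert_if)
    then have "card ({1..n} - {a, b, c, p b, p c}) \<ge> 2"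
      using n diff_card_le_card_Diff[of "{a, b, c, p b, p c}" "{1..n}"] by simp
    then obtain d e where "d \<in> {1..n} - {a, b, c, p b, p c}" "e \<in> {1..n} - {a, b, c, p b, p c}" "d \<noteq> e"
      by (rule obtain_subset_with_card_n) (auto simp: card_2_iff)
    then have "N = carrier (alt_group n)"
      using n by (intro alt_group_normal_two_fixpoints[OF _ N kN kc, of d e] kfix) auto
    then show ?thesis ..
  qed
qed

section \<open>Embedding into alternating groups\<close>

text \<open>Cayley's theorem: left multiplication, transported to \<open>{1..order G}\<close> along
  a numbering \<open>h\<close> of the elements.\<close>

lemma cayley_sym_group:
  fixes G :: "('a, 'm) monoid_scheme" (structure)
  assumes "group G" "finite (carrier G)"
  obtains \<phi> where "\<phi> \<in> hom G (sym_group (order G))" "inj_on \<phi> (carrier G)"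
proof -
  interpret group G by fact
  obtain h where h: "bij_betw h {1..order G} (carrier G)"
    using ex_bij_betw_nat_finite_1[OF assms(2)] by (auto simp: order_def)
  define h' where "h' = inv_into {1..order G} h"
  have h'h: "h' (h x) = x" if "x \<in> {1..order G}" for x
    using h that by (simp add: h'_def bij_betw_inv_into_left)
  have hh': "h (h' g) = g" if "g \<in> carrier G" for g
    using h that by (simp add: h'_def bij_betw_inv_into_right)
  have hC: "h x \<in> carrier G" if "x \<in> {1..order G}" for x
    using h that by (auto simp: bij_betw_def)
  have h'C: "h' g \<in> {1..order G}" if "g \<in> carrier G" for g
    using bij_betw_inv_into[OF h] that by (auto simp: h'_def bij_betw_def)
  \<comment> \<open>Elements of \<open>sym_group\<close> are functions on all naturals, and
    \<open>permutes\<close> requires them to be the identity off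
    \<open>{1..order G}\<close>.\<close>
  define \<phi> where "\<phi> g x = (if x \<in> {1..order G} then h' (g \<otimes> h x) else x)" for g x
  have mult: "\<phi> (g \<otimes> g') = \<phi> g \<circ> \<phi> g'" if "g \<in> carrier G" "g' \<in> carrier G" for g g'
  proof
    fix x
    show "\<phi> (g \<otimes> g') x = (\<phi> g \<circ> \<phi> g') x"
      using that h'C[of "g' \<otimes> h x"] hC[of x] hh'[of "g' \<otimes> h x"] by (auto simp: \<phi>_def m_assoc)
  qed
  have one: "\<phi> \<one> = id"
    using hC h'h by (auto simp: \<phi>_def fun_eq_iff)
  have perm: "\<phi> g permutes {1..order G}" if "g \<in> carrier G" for g
  proof -
    have "bij (\<phi> g)"
      using that mult[of g "inv g"] mult[of "inv g" g] one by (intro o_bij[of "\<phi> (inv g)"]) auto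
    moreover have "\<phi> g x = x" if "x \<notin> {1..order G}" for x
      using that by (auto simp: \<phi>_def)
    ultimately show ?thesis
      unfolding permutes_def bij_iff by blast
  qed
  have "inj_on \<phi> (carrier G)"
  proof (rule inj_onI)
    fix g g' assume g: "g \<in> carrier G" "g' \<in> carrier G" and eq: "\<phi> g = \<phi> g'"
    \<comment> \<open>The value at the number of the identity element is the number of
      \<open>g\<close>.\<close>
    have "h' g = h' g'"
      using fun_cong[OF eq, of "h' \<one>"] h'C[OF one_closed] hh'[OF one_closed] g
      by (simp add: \<phi>_def)
    then show "g = g'"
      using hh' g by metis
  qed
  moreover have "\<phi> \<in> hom G (sym_group (order G))"
    using perm mult by (intro homI) (simp_all add: sym_group_def)
  ultimately show thesis
    using that by blast
qed

text \<open>Odd permutations are made even by the transposition \<open>\<tau>\<close> of two extra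
  points. As \<open>\<tau>\<close> is an involution commuting with everything that fixes these
  points, the correction is multiplicative: two factors \<open>\<tau>\<close> cancel.\<close>

lemma sym_group_embeds_alt_group:
  assumes m: "m \<ge> n + 2"
  obtains \<psi> where "\<psi> \<in> hom (sym_group n) (alt_group m)" "inj_on \<psi> (carrier (sym_group n))"
proof -
  define \<tau> where "\<tau> = transpose (Suc n) (Suc (Suc n))"
  define \<psi> where "\<psi> p = (if evenperm p then p else p \<circ> \<tau>)" for p
  have \<tau>: "\<tau> permutes {1..m}" "permutation \<tau>" "\<not> evenperm \<tau>" "\<tau> \<circ> \<tau> = id"
    unfolding \<tau>_def using m by (auto simp: permutes_swap_id permutation_swap_id evenperm_swap)
  have perm: "permutation p" if "p permutes {1..n}" for p
    using that by (auto simp: permutation_permutes)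
  have \<tau>_comm: "p \<circ> \<tau> = \<tau> \<circ> p" if "p permutes {1..n}" for p
  proof
    fix x
    have "p (Suc n) = Suc n" "p (Suc (Suc n)) = Suc (Suc n)"
      using that permutes_not_in[OF that] by auto
    then show "(p \<circ> \<tau>) x = (\<tau> \<circ> p) x"
      using inj_eq[OF permutes_inj[OF that], of x "Suc n"] inj_eq[OF permutes_inj[OF that], of x "Suc (Suc n)"]
      by (auto simp: \<tau>_def transpose_def)
  qed
  have "\<psi> \<in> hom (sym_group n) (alt_group m)"
  proof (rule homI)
    fix p assume "p \<in> carrier (sym_group n)"
    then have p: "p permutes {1..n}"
      by (simp add: sym_group_carrier)
    then have pm: "p permutes {1..m}"
      using m by (elim permutes_subset) auto
    then show "\<psi> p \<in> carrier (alt_group m)"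
      using permutes_compose[OF \<tau>(1) pm] \<tau>(2,3) perm[OF p]
      by (auto simp: \<psi>_def alt_group_carrier evenperm_comp)
  next
    fix p q assume "p \<in> carrier (sym_group n)" "q \<in> carrier (sym_group n)"
    then have p: "p permutes {1..n}" and q: "q permutes {1..n}"
      by (simp_all add: sym_group_carrier)
    have 1: "p \<circ> \<tau> \<circ> q = p \<circ> q \<circ> \<tau>"
      by (simp only: o_assoc[symmetric] \<tau>_comm[OF q])
    have 2: "p \<circ> \<tau> \<circ> (q \<circ> \<tau>) = p \<circ> q"
      by (metis 1 \<tau>(4) comp_assoc comp_id)
    show "\<psi> (p \<otimes>\<^bsub>sym_group n\<^esub> q) = \<psi> p \<otimes>\<^bsub>alt_group m\<^esub> \<psi> q"
      using 1 2 by (auto simp: \<psi>_def sym_group_mult alt_group_mult evenperm_comp[OF perm[OF p] perm[OF q]] o_assoc)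
  qed
  moreover have "inj_on \<psi> (carrier (sym_group n))"
  proof (rule inj_onI)
    fix p q assume "p \<in> carrier (sym_group n)" "q \<in> carrier (sym_group n)" and eq: "\<psi> p = \<psi> q"
    then have p: "p permutes {1..n}" and q: "q permutes {1..n}"
      by (simp_all add: sym_group_carrier)
    \<comment> \<open>\<open>\<tau>\<close> moves no point of \<open>{1..n}\<close>, so
      \<open>\<psi>\<close> only alters values outside, where both permutations are the
      identity.\<close>
    have restrict: "p' x = \<psi> p' x" if "x \<in> {1..n}" for p' x
      using that by (auto simp: \<psi>_def \<tau>_def transpose_def)
    show "p = q"
    proof
      fix x show "p x = q x"
        using restrict[of x] eq permutes_not_in[OF p, of x] permutes_not_in[OF q, of x] by metis
    qed
  qed
  ultimately show thesis
    using that by blast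
qed

lemma embeds_alt_group:
  fixes G :: "('a, 'm) monoid_scheme"
  assumes "group G" "finite (carrier G)" "m \<ge> order G + 2"
  obtains \<phi> where "\<phi> \<in> hom G (alt_group m)" "inj_on \<phi> (carrier G)"
proof -
  obtain \<phi> where \<phi>: "\<phi> \<in> hom G (sym_group (order G))" "inj_on \<phi> (carrier G)"
    using cayley_sym_group[OF assms(1,2)] .
  obtain \<psi> where \<psi>: "\<psi> \<in> hom (sym_group (order G)) (alt_group m)"
    "inj_on \<psi> (carrier (sym_group (order G)))"
    using sym_group_embeds_alt_group[OF assms(3)] .
  have "\<phi> ` carrier G \<subseteq> carrier (sym_group (order G))"
    using \<phi>(1) by (auto simp: hom_def)
  then show thesis
    using that[of "\<psi> \<circ> \<phi>"] hom_compose[OF \<phi>(1) \<psi>(1)] \<phi>(2) \<psi>(2) comp_inj_on inj_on_subset by metis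
qed

section \<open>Complexity\<close>

text \<open>Where the series from constructability first leaves \<open>K\<close>, simplicity makes
  it drop straight to the trivial group, so that factor is a copy of \<open>K\<close>
  itself.\<close>

lemma (in complexity_function) simple_group_le_1:
  fixes K :: "nat monoid"
  assumes "simple_group K" "finite (carrier K)"
  shows "c K \<le> 1"
proof -
  interpret simple_group K by fact
  obtain n S where S: "S 0 = carrier K" "S n = {\<one>\<^bsub>K\<^esub>}"
    and step: "\<And>i. i < n \<Longrightarrow> S (Suc i) \<lhd> K\<lparr>carrier := S i\<rparr> \<and>
      value_at c (K\<lparr>carrier := S i\<rparr> Mod S (Suc i)) \<le> 1"
    using constructability[OF is_group assms(2)] by blast
  have "S n \<noteq> carrier K"
    using S(2) simple_not_triv by simp
  \<comment> \<open>The series may repeat \<open>K\<close> at its start; \<open>i\<close> is the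
    last index before the first proper term.\<close>
  then obtain i where i: "i < n" "S i = carrier K" "S (Suc i) \<noteq> carrier K"
    using S(1) ex_least_nat_less[of "\<lambda>i. S i \<noteq> carrier K" n] by auto
  have triv: "S (Suc i) = {\<one>\<^bsub>K\<^esub>}" and le: "value_at c (K Mod {\<one>\<^bsub>K\<^esub>}) \<le> 1"
    using step[OF i(1)] i(2,3) no_real_normal_subgroup[of "S (Suc i)"] by simp_all
  have "(K Mod {\<one>\<^bsub>K\<^esub>}) \<cong> K"
    using trivial_factor_iso by (auto simp: is_iso_def)
  moreover from this have "finite (carrier (K Mod {\<one>\<^bsub>K\<^esub>}))"
    using assms(2) group.iso_sym[OF normal.factorgroup_is_group[OF one_is_normal]] iso_finite by blast
  ultimately have "value_at c (K Mod {\<one>\<^bsub>K\<^esub>}) = c K"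
    by (intro value_at_eq normal.factorgroup_is_group one_is_normal is_group)
  with le show ?thesis
    by simp
qed

text \<open>The subgroup axiom speaks of actual subgroups of a group over \<open>nat\<close>.
  Passing to the image of \<open>\<phi>\<close>, which is isomorphic to \<open>G\<close>, extends it
  to embedded groups over any type.\<close>

lemma (in complexity_function) value_at_le_of_embedding:
  fixes K :: "nat monoid" and G :: "('a, 'm) monoid_scheme"
  assumes sub: "subgroup_axiom c" and G: "group G" "finite (carrier G)"
    and K: "group K" "finite (carrier K)" and \<phi>: "\<phi> \<in> hom G K" "inj_on \<phi> (carrier G)"
  shows "value_at c G \<le> c K"
proof -
  interpret group_hom G K \<phi>
    using G K \<phi> by (simp add: group_hom_def group_hom_axioms_def)
  have "\<phi> \<in> iso G (K\<lparr>carrier := \<phi> ` carrier G\<rparr>)"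
    using \<phi> by (auto simp: iso_def hom_def bij_betw_def)
  then have "value_at c G = c (K\<lparr>carrier := \<phi> ` carrier G\<rparr>)"
    using group.subgroup_imp_group[OF K(1) img_is_subgroup]
    by (intro value_at_eq[OF G]) (auto simp: is_iso_def)
  also have "\<dots> \<le> c K"
    using sub K img_is_subgroup unfolding subgroup_axiom_def by blast
  finally show ?thesis .
qed

theorem proposition3p1:
  fixes c :: "nat monoid \<Rightarrow> nat" and G :: "('a, 'm) monoid_scheme"
  assumes "complexity_function c"
    and "subgroup_axiom c"
    and "group G" and "finite (carrier G)"
  shows "value_at c G \<le> 1"
proof -
  interpret complexity_function c by fact
  \<comment> \<open>Large enough both for the embedding (\<open>order G + 2\<close>) and for
    simplicity (\<open>7\<close>).\<close>
  define m where "m = order G + 7"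
  have fin: "finite (carrier (alt_group m))"
    using finite_permutations[of "{1..m}"] by (rule finite_subset[rotated]) (auto simp: alt_group_carrier)
  \<comment> \<open>The elements of \<open>alt_group m\<close> are functions, so \<open>c\<close>
    applies only to a copy over \<open>nat\<close>, to which simplicity is carried along
    \<open>\<psi>\<close>.\<close>
  obtain K :: "nat monoid" and \<psi> where K: "group K" and \<psi>: "\<psi> \<in> iso (alt_group m) K"
    using ex_nat_copy[OF alt_group_is_group fin] by (auto simp: is_iso_def)
  have finK: "finite (carrier K)"
    using fin \<psi> bij_betw_finite by (auto simp: iso_def)
  have simple: "simple_group K"
    using simple_group.iso_simple[OF alt_group_simple K \<psi>] by (simp add: m_def)
  obtain \<phi> where \<phi>: "\<phi> \<in> hom G (alt_group m)" "inj_on \<phi> (carrier G)"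
    using embeds_alt_group[OF assms(3,4), of m] by (auto simp: m_def)
  have "\<psi> \<circ> \<phi> \<in> hom G K"
    using hom_compose[OF \<phi>(1)] \<psi> by (auto simp: iso_def)
  moreover have "inj_on (\<psi> \<circ> \<phi>) (carrier G)"
  proof (rule comp_inj_on[OF \<phi>(2)])
    show "inj_on \<psi> (\<phi> ` carrier G)"
      using \<phi>(1) \<psi> by (auto simp: iso_def bij_betw_def hom_def intro: inj_on_subset)
  qed
  ultimately have "value_at c G \<le> c K"
    using value_at_le_of_embedding[OF assms(2-4) K finK] by blast
  also have "\<dots> \<le> 1"
    using simple finK by (rule simple_group_le_1)
  finally show ?thesis .
qed

end
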